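(* Suppose that $A\subset\mathbb{R}$ is Lebesgue measurable, $B\subset\mathbb{R}$ is an $F_\sigma$ set, and $\overline{d}(B,x)>0$ for every $x\in B$. Then there is a null set $N\subset A$ such that $N+B=A+B$.
   Context: A set is null if its Lebesgue measure is $0$. For $E,F\subset\mathbb{R}$, $E+F=\{e+f : e\in E,\ f\in F\}$. For a Lebesgue measurable set $E\subset\mathbb{R}$, with $|\cdot|$ denoting Lebesgue measure, the upper density of $E$ at $x$ is $\overline{d}(E,x)=\limsup_{h\to 0^+}\frac{|E\cap[x-h,x+h]|}{2h}$. *)

theory Defs
  imports "HOL-Analysis.Analysis"
begin

(* Intended for Lebesgue measurable E.  The limsup is taken in ereal, a complete lattice;
   for h > 0 the quotient lies in [0, 1], so nothing is lost by the embedding. *)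
definition upper_density :: "real set \<Rightarrow> real \<Rightarrow> ereal" where
  "upper_density E x =
     Limsup (at_right 0) (\<lambda>h. ereal (measure lebesgue (E \<inter> {x - h..x + h}) / (2 * h)))"

end

theory Submission
  imports Defs
begin

text \<open>A sum \<open>s = a + b\<close> lies in \<open>N + B\<close> iff \<open>N\<close> meets the reflected set \<open>s - B\<close>. The points of \<open>A\<close>
  that are not density points of \<open>A\<close> form a null set, which is put into \<open>N\<close>; if \<open>a\<close> is a density
  point, the positive upper density of \<open>B\<close> at \<open>b\<close> makes \<open>A \<inter> (s - B)\<close> a set of positive measure.
  Hence \<open>F \<inter> (s - K)\<close> has positive measure for some compact \<open>F\<close>, \<open>K\<close> from fixed countable
  decompositions of \<open>A\<close> (up to a null set) and \<open>B\<close>. It remains to find, for compact \<open>F\<close> and \<open>K\<close>, a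
  null subset of \<open>F\<close> meeting every \<open>F \<inter> (s - K)\<close> of positive measure. For \<open>s\<close> in the compact set
  where this measure is at least \<open>1/n\<close>, it is the intersection of a decreasing sequence of compact
  sets of measure tending to 0. Each is obtained from the previous one by intersecting it with a fine
  periodic set of small density: this set is so evenly spread that it keeps positive measure in all
  the sets \<open>F \<inter> (s - K)\<close> at once, by compactness and the continuity of translation in measure.\<close>

section \<open>Reflections and the continuity of translation in measure\<close>

lemma mem_reflection_iff: "x \<in> (-) s ` S \<longleftrightarrow> s - x \<in> S" for s :: "'a::ab_group_add"
  by (force intro: image_eqI[of _ _ "s - x"])

text \<open>The form with the scalar \<open>-1\<close> is the one to which the affine change of
  variables applies.\<close>

lemma reflection_eq_affine: "(-) s ` S = (\<lambda>x. (-1) *\<^sub>R x + s) ` S" for s :: real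
  by (rule image_cong) auto

lemma emeasure_reflection: "emeasure lebesgue ((-) s ` S) = emeasure lebesgue S" for s :: real
  unfolding reflection_eq_affine using emeasure_lebesgue_affine[of "-1" s S] by simp

lemma measure_reflection: "measure lebesgue ((-) s ` S) = measure lebesgue S" for s :: real
  unfolding measure_def emeasure_reflection ..

lemma sets_lebesgue_reflection:
  fixes s :: real
  assumes "S \<in> sets lebesgue"
  shows "(-) s ` S \<in> sets lebesgue"
proof -
  have "(\<lambda>x. s + (-1) * x) \<in> lebesgue \<rightarrow>\<^sub>M lebesgue"
    using lebesgue_affine_measurable[of "\<lambda>_. -1" s] by simp
  from measurable_sets[OF this assms] show ?thesis
    by (rule back_subst[of "\<lambda>X. X \<in> sets lebesgue"]) (auto simp: mem_reflection_iff)
qed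

lemma compact_reflection: "compact S \<Longrightarrow> compact ((-) s ` S)" for s :: real
  by (intro compact_continuous_image continuous_intros)

lemma lmeasurable_Int_compact_reflection:
  fixes A K :: "real set"
  assumes "compact A" "compact K"
  shows "A \<inter> (-) s ` K \<in> lmeasurable"
  using assms compact_reflection by (intro fmeasurable.Int lmeasurable_compact) auto

text \<open>The bound is symmetric in \<^term>\<open>s\<close> and \<^term>\<open>t\<close> because both reflections have the measure of
  \<^term>\<open>K\<close>.\<close>
lemma reflection_continuous:
  fixes K :: "real set"
  assumes K: "compact K" and "e > 0"
  obtains d where "d > 0"
    "\<And>s t. \<bar>s - t\<bar> < d \<Longrightarrow> measure lebesgue ((-) s ` K - (-) t ` K) < e"
proof -
  have "K \<in> sets lebesgue" using K lmeasurable_compact by blast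
  then obtain U where U: "open U" "K \<subseteq> U" "U - K \<in> lmeasurable" "emeasure lebesgue (U - K) < ennreal e"
    using sets_lebesgue_outer_open \<open>e > 0\<close> by blast
  then have mU: "measure lebesgue (U - K) < e"
    by (metis \<open>e > 0\<close> emeasure_eq_measure2 ennreal_less_iff measure_nonneg)
  obtain d where d: "d > 0" "(\<Union>x\<in>K. ball x d) \<subseteq> U"
    using compact_subset_open_imp_ball_epsilon_subset[OF K U(1,2)] by blast
  show ?thesis
  proof (rule that[OF d(1)])
    fix s t :: real
    assume st: "\<bar>s - t\<bar> < d"
    \<comment> \<open>For \<open>x\<close> in the difference, \<open>s - x\<close> lies in
      \<open>K\<close>. As \<open>t - x\<close> is within \<open>d\<close> of it,
      \<open>t - x\<close> lies in \<open>U\<close>, but not in \<open>K\<close>.\<close>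
    have "(-) s ` K - (-) t ` K \<subseteq> (-) t ` (U - K)"
    proof
      fix x assume x: "x \<in> (-) s ` K - (-) t ` K"
      then have "t - x \<in> ball (s - x) d" using st by (auto simp: dist_real_def)
      then show "x \<in> (-) t ` (U - K)"
        using x d(2) unfolding mem_reflection_iff Diff_iff by blast
    qed
    moreover have "(-) t ` (U - K) \<in> lmeasurable"
      using U(3) sets_lebesgue_reflection[of "U - K" t]
      unfolding fmeasurable_def by (simp add: emeasure_reflection del: emeasure_completion)
    moreover have "(-) s ` K - (-) t ` K \<in> sets lebesgue"
      using \<open>K \<in> sets lebesgue\<close> sets_lebesgue_reflection by (metis sets.Diff)
    ultimately have "measure lebesgue ((-) s ` K - (-) t ` K) \<le> measure lebesgue ((-) t ` (U - K))"
      by (intro measure_mono_fmeasurable)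
    then show "measure lebesgue ((-) s ` K - (-) t ` K) < e"
      using mU by (simp add: measure_reflection)
  qed
qed

lemma measure_le_Int_plus_Diff:
  assumes "S \<in> fmeasurable M" "T \<in> sets M"
  shows "measure M S \<le> measure M (S \<inter> T) + measure M (S - T)"
proof -
  have "measure M ((S \<inter> T) \<union> (S - T)) \<le> measure M (S \<inter> T) + measure M (S - T)"
    using assms by (intro measure_Un_le) auto
  moreover have "(S \<inter> T) \<union> (S - T) = S" by blast
  ultimately show ?thesis by simp
qed

lemma measure_Int_reflection_le:
  fixes A K :: "real set"
  assumes "compact A" "compact K"
  shows "measure lebesgue (A \<inter> (-) s ` K) \<le>
    measure lebesgue (A \<inter> (-) t ` K) + measure lebesgue ((-) s ` K - (-) t ` K)"
proof -
  have K: "(-) u ` K \<in> lmeasurable" for u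
    using assms(2) compact_reflection lmeasurable_compact by blast
  have A: "A \<in> lmeasurable" using assms(1) lmeasurable_compact by blast
  have "measure lebesgue (A \<inter> (-) s ` K) \<le>
      measure lebesgue ((A \<inter> (-) t ` K) \<union> ((-) s ` K - (-) t ` K))"
    using A K by (intro measure_mono_fmeasurable fmeasurable.Un fmeasurable.Diff fmeasurable.Int
        fmeasurableD) auto
  also have "\<dots> \<le> measure lebesgue (A \<inter> (-) t ` K) + measure lebesgue ((-) s ` K - (-) t ` K)"
    using A K by (intro measure_Un_le sets.Int sets.Diff fmeasurableD) auto
  finally show ?thesis .
qed

lemma continuous_measure_Int_reflection:
  fixes A K :: "real set"
  assumes "compact A" "compact K"
  shows "continuous_on UNIV (\<lambda>s. measure lebesgue (A \<inter> (-) s ` K))"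
  unfolding continuous_on_iff
proof (intro ballI allI impI)
  fix s e :: real
  assume "e > 0"
  then obtain d where d: "d > 0"
    "\<And>s t. \<bar>s - t\<bar> < d \<Longrightarrow> measure lebesgue ((-) s ` K - (-) t ` K) < e"
    using reflection_continuous[OF assms(2)] by metis
  have "dist (measure lebesgue (A \<inter> (-) t ` K)) (measure lebesgue (A \<inter> (-) s ` K)) < e"
    if "dist t s < d" for t
    using measure_Int_reflection_le[OF assms, of s t] measure_Int_reflection_le[OF assms, of t s]
      d(2)[of s t] d(2)[of t s] that
    by (simp add: dist_real_def abs_minus_commute)
  with d(1) show "\<exists>d>0. \<forall>t\<in>UNIV. dist t s < d \<longrightarrow>
      dist (measure lebesgue (A \<inter> (-) t ` K)) (measure lebesgue (A \<inter> (-) s ` K)) < e"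
    by blast
qed

text \<open>Continuity makes the set closed, and \<open>c > 0\<close> makes the intersection
  nonempty, which forces \<open>s\<close> into the compact set of sums of \<open>A\<close> and
  \<open>K\<close>. The set where the measure is merely positive is open, hence the
  threshold.\<close>

lemma compact_measure_Int_reflection_ge:
  fixes A K :: "real set"
  assumes A: "compact A" and K: "compact K" and "c > 0"
  shows "compact {s. c \<le> measure lebesgue (A \<inter> (-) s ` K)}" (is "compact ?S")
proof -
  have "closed ?S"
    using continuous_measure_Int_reflection[OF A K] by (intro closed_Collect_le continuous_intros)
  moreover have "?S \<subseteq> {x + y | x y. x \<in> A \<and> y \<in> K}"
  proof
    fix s assume "s \<in> ?S"
    with \<open>c > 0\<close> have "A \<inter> (-) s ` K \<noteq> {}" by auto
    then obtain a where "a \<in> A" "s - a \<in> K"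
      by (metis Int_iff ex_in_conv mem_reflection_iff)
    then show "s \<in> {x + y | x y. x \<in> A \<and> y \<in> K}" by force
  qed
  ultimately show ?thesis
    using closed_Int_compact[OF _ compact_sums[OF A K], of ?S] by (simp add: Int_absorb2)
qed

section \<open>Lebesgue density points\<close>

text \<open>Lebesgue differentiation, applied to the indicator of \<open>E\<close> on intervals that
  start at the point: almost everywhere on \<open>E\<close> the averages tend to 1.\<close>

lemma right_density_points:
  fixes E :: "real set"
  assumes E: "E \<in> sets lebesgue"
  obtains N where "negligible N"
    "\<And>x e. \<lbrakk>x \<in> E - N; 0 < e\<rbrakk> \<Longrightarrow>
      \<exists>d>0. \<forall>h. 0 < h \<and> h < d \<longrightarrow> measure lebesgue ({x..x + h} - E) \<le> e * h"
proof -
  have fin: "E \<inter> {a..b} \<in> lmeasurable" for a b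
    using E by (metis fmeasurable_Int_fmeasurable inf_commute lmeasurable_interval(1) cbox_interval)
  have int: "indicat_real E integrable_on cbox a b" for a b
    using fin by (simp add: integrable_on_indicator)
  obtain N where N: "negligible N"
      "\<And>x e. \<lbrakk>x \<notin> N; 0 < e\<rbrakk> \<Longrightarrow> \<exists>d>0. \<forall>h. 0 < h \<and> h < d \<longrightarrow>
         norm (integral (cbox x (x + h *\<^sub>R One)) (indicat_real E) /\<^sub>R h ^ DIM(real) - indicat_real E x) < e"
    using integrable_ccontinuous_explicit[of "indicat_real E", OF int] by blast
  show ?thesis
  proof (rule that[OF N(1)])
    fix x e :: real
    assume x: "x \<in> E - N" and "0 < e"
    then obtain d where d: "d > 0" "\<And>h. 0 < h \<and> h < d \<Longrightarrow>
         norm (integral (cbox x (x + h *\<^sub>R One)) (indicat_real E) /\<^sub>R h ^ DIM(real) - indicat_real E x) < e"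
      using N(2)[of x e] by blast
    have "measure lebesgue ({x..x + h} - E) \<le> e * h" if h: "0 < h \<and> h < d" for h
    proof -
      have "integral {x..x + h} (indicat_real E) = measure lebesgue (E \<inter> {x..x + h})"
        using fin by (simp add: integral_indicator)
      then have "\<bar>measure lebesgue (E \<inter> {x..x + h}) / h - 1\<bar> < e"
        using d(2)[OF h] x by (simp add: divide_inverse mult.commute)
      then have "measure lebesgue (E \<inter> {x..x + h}) / h > 1 - e" by linarith
      then have 1: "measure lebesgue (E \<inter> {x..x + h}) \<ge> h - e * h"
        using h by (simp add: field_simps)
      have "measure lebesgue ({x..x + h} - E \<inter> {x..x + h})
          = measure lebesgue {x..x + h} - measure lebesgue (E \<inter> {x..x + h})"
        using fin by (intro measurable_measure_Diff fmeasurableD) auto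
      moreover have "{x..x + h} - E \<inter> {x..x + h} = {x..x + h} - E" by blast
      ultimately show ?thesis using 1 h by simp
    qed
    with d(1) show "\<exists>d>0. \<forall>h. 0 < h \<and> h < d \<longrightarrow> measure lebesgue ({x..x + h} - E) \<le> e * h"
      by blast
  qed
qed

text \<open>The one-sided result is applied to \<open>E\<close> and to its mirror image in 0; the
  two exceptional sets are united and the two errors added.\<close>

lemma lebesgue_density_points:
  fixes E :: "real set"
  assumes E: "E \<in> sets lebesgue"
  obtains N where "negligible N"
    "\<And>x e. \<lbrakk>x \<in> E - N; 0 < e\<rbrakk> \<Longrightarrow>
      \<exists>d>0. \<forall>h. 0 < h \<and> h < d \<longrightarrow> measure lebesgue ({x - h..x + h} - E) \<le> e * h"
proof -
  have E': "(-) 0 ` E \<in> sets lebesgue" using E by (rule sets_lebesgue_reflection)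
  obtain N1 where N1: "negligible N1" "\<And>x e. \<lbrakk>x \<in> E - N1; 0 < e\<rbrakk> \<Longrightarrow>
      \<exists>d>0. \<forall>h. 0 < h \<and> h < d \<longrightarrow> measure lebesgue ({x..x + h} - E) \<le> e * h"
    using right_density_points[OF E] by blast
  obtain N2 where N2: "negligible N2" "\<And>x e. \<lbrakk>x \<in> (-) 0 ` E - N2; 0 < e\<rbrakk> \<Longrightarrow>
      \<exists>d>0. \<forall>h. 0 < h \<and> h < d \<longrightarrow> measure lebesgue ({x..x + h} - (-) 0 ` E) \<le> e * h"
    using right_density_points[OF E'] by blast
  show ?thesis
  proof
    have "negligible ((-) 0 ` N2)"
      using N2(1) sets_lebesgue_reflection[of N2 0]
      by (auto simp: negligible_iff_null_sets emeasure_reflection simp del: diff_0 emeasure_completion intro!: null_setsI)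
    then show "negligible (N1 \<union> (-) 0 ` N2)" using N1(1) by (simp add: negligible_Un)
  next
    fix x e :: real
    assume x: "x \<in> E - (N1 \<union> (-) 0 ` N2)" and e: "0 < e"
    then have x2: "-x \<in> (-) 0 ` E - N2" and x1: "x \<in> E - N1"
      unfolding Diff_iff Un_iff mem_reflection_iff by auto
    obtain d1 where d1: "d1 > 0"
      "\<And>h. 0 < h \<and> h < d1 \<Longrightarrow> measure lebesgue ({x..x + h} - E) \<le> e/2 * h"
      using N1(2)[OF x1, of "e/2"] e by auto
    obtain d2 where d2: "d2 > 0"
      "\<And>h. 0 < h \<and> h < d2 \<Longrightarrow> measure lebesgue ({-x..-x + h} - (-) 0 ` E) \<le> e/2 * h"
      using N2(2)[OF x2, of "e/2"] e by auto
    have "measure lebesgue ({x - h..x + h} - E) \<le> e * h" if h: "0 < h \<and> h < min d1 d2" for h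
    proof -
      \<comment> \<open>Reflection in 0 turns an interval ending at \<open>x\<close> into one
        starting at \<open>-x\<close>.\<close>
      have "{x - h..x} - E = (-) 0 ` ({-x..-x + h} - (-) 0 ` E)"
        by (rule set_eqI) (unfold mem_reflection_iff Diff_iff, auto)
      then have 2: "measure lebesgue ({x - h..x} - E) \<le> e/2 * h"
        using d2(2)[of h] h by (simp only: measure_reflection) simp
      have "{x - h..x + h} - E = ({x - h..x} - E) \<union> ({x..x + h} - E)" using h by auto
      then have "measure lebesgue ({x - h..x + h} - E)
          \<le> measure lebesgue ({x - h..x} - E) + measure lebesgue ({x..x + h} - E)"
        using E by (simp only:) (intro measure_Un_le sets.Diff, auto)
      then show ?thesis using 2 d1(2)[of h] h by simp
    qed
    then show "\<exists>d>0. \<forall>h. 0 < h \<and> h < d \<longrightarrow> measure lebesgue ({x - h..x + h} - E) \<le> e * h"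
      using d1(1) d2(1) by (intro exI[of _ "min d1 d2"]) auto
  qed
qed

section \<open>Evenly spread compact sets of small density\<close>

text \<open>\<open>\<theta>\<close> is the density and \<open>1 / m\<close> the period: for
  \<open>\<theta>\<close> between 0 and 1 and positive \<open>m\<close>, refining the comb leaves
  its total length unchanged. Stopping at finitely many closed teeth keeps it compact.\<close>

definition comb :: "real \<Rightarrow> nat \<Rightarrow> nat \<Rightarrow> real set" where
  "comb \<theta> R m = (\<Union>k\<in>{- int (R * m)..<int (R * m)}. {real_of_int k / m..(real_of_int k + \<theta>) / m})"

lemma compact_comb: "compact (comb \<theta> R m)"
  unfolding comb_def by (intro compact_UN) auto

lemma measure_comb_le:
  assumes "0 < \<theta>" "0 < m"
  shows "measure lebesgue (comb \<theta> R m) \<le> 2 * real R * \<theta>"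
proof -
  have "measure lebesgue (comb \<theta> R m) \<le> (\<Sum>k\<in>{- int (R * m)..<int (R * m)}. \<theta> / m)"
    unfolding comb_def
    using assms by (intro order.trans[OF measure_UNION_le] sum_mono) (auto simp: field_simps)
  also have "\<dots> = 2 * real (R * m) * (\<theta> / m)" by simp
  also have "\<dots> = 2 * real R * \<theta>" using assms by simp
  finally show ?thesis .
qed

text \<open>Every cell inside \<open>{a..b}\<close> contributes \<open>\<theta> / m\<close>, and
  rounding at the two ends costs at most two cells, an error that vanishes as \<open>m\<close>
  grows.\<close>

lemma measure_comb_Int_ge:
  fixes a b :: real
  assumes \<theta>: "0 < \<theta>" "\<theta> < 1" and m: "0 < m" and ab: "- real R \<le> a" "b \<le> R"
  shows "\<theta> * (b - a) - 2 * \<theta> / m \<le> measure lebesgue (comb \<theta> R m \<inter> {a..b})"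
proof -
  \<comment> \<open>These are the \<open>k\<close> whose whole cell, from \<open>k / m\<close> to
    \<open>(k + 1) / m\<close>, lies in \<open>{a..b}\<close>.\<close>
  define I where "I = {\<lceil>a * m\<rceil>..<\<lfloor>b * m\<rfloor>}"
  define F where "F k = {real_of_int k / m..(real_of_int k + \<theta>) / m}" for k
  have "pairwise (\<lambda>i j. disjnt (F i) (F j)) I"
  proof -
    have "disjnt (F i) (F j)" if "i < j" for i j
    proof -
      \<comment> \<open>Since \<open>\<theta> < 1\<close>, the closed teeth of distinct cells do not
        even touch.\<close>
      have "real_of_int i + 1 \<le> real_of_int j" using that by linarith
      then have "(real_of_int i + \<theta>) / m < real_of_int j / m"
        using \<theta> m by (intro divide_strict_right_mono) auto
      then show ?thesis by (auto simp: disjnt_def F_def)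
    qed
    then show ?thesis by (intro pairwiseI) (meson disjnt_sym neqE)
  qed
  then have "measure lebesgue (\<Union>k\<in>I. F k) = (\<Sum>k\<in>I. measure lebesgue (F k))"
    by (intro measure_UNION') (auto simp: I_def F_def)
  also have "\<dots> = (\<Sum>k\<in>I. \<theta> / m)"
    using \<theta> m by (intro sum.cong) (auto simp: F_def field_simps)
  also have "\<dots> = real (card I) * (\<theta> / m)" by simp
  finally have "measure lebesgue (\<Union>k\<in>I. F k) = real (card I) * (\<theta> / m)" .
  moreover have "b * m - a * m - 2 \<le> real (card I)" unfolding I_def card_atLeastLessThan_int by linarith
  then have "(b * m - a * m - 2) * (\<theta> / m) \<le> real (card I) * (\<theta> / m)"
    using \<theta> by (intro mult_right_mono) auto
  moreover have "(b * m - a * m - 2) * (\<theta> / m) = \<theta> * (b - a) - 2 * \<theta> / m"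
    using m by (simp add: field_simps)
  moreover have "(\<Union>k\<in>I. F k) \<subseteq> comb \<theta> R m \<inter> {a..b}"
  proof
    fix x assume "x \<in> (\<Union>k\<in>I. F k)"
    then obtain k where k: "k \<in> I" "x \<in> F k" by blast
    have k1: "a * m \<le> k" using k(1) unfolding I_def by (simp add: ceiling_le_iff)
    have k2: "real_of_int k + 1 \<le> b * m" using k(1) unfolding I_def by simp linarith
    have "- (real R * m) \<le> a * m" using ab m mult_right_mono[of "- real R" a m] by simp
    then have "real_of_int (- int (R * m)) \<le> real_of_int k" using k1 by simp
    moreover have "b * m \<le> real R * m" using ab m by (intro mult_right_mono) auto
    then have "real_of_int k < real_of_int (int (R * m))" using k2 by simp
    ultimately have "x \<in> comb \<theta> R m"
      using k(2) unfolding comb_def F_def of_int_le_iff of_int_less_iff by auto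
    moreover have "a \<le> k / m" using k1 m by (simp add: field_simps)
    moreover have "(k + \<theta>) / m \<le> b" using k2 m \<theta> by (simp add: field_simps)
    ultimately show "x \<in> comb \<theta> R m \<inter> {a..b}" using k(2) unfolding F_def by auto
  qed
  moreover have "comb \<theta> R m \<inter> {a..b} \<in> lmeasurable"
    using compact_comb by (intro lmeasurable_compact) (auto intro: compact_Int)
  moreover have "(\<Union>k\<in>I. F k) \<in> sets lebesgue"
    by (intro sets.finite_UN) (auto simp: I_def F_def)
  ultimately show ?thesis
    using measure_mono_fmeasurable[of "\<Union>k\<in>I. F k" "comb \<theta> R m \<inter> {a..b}" lebesgue] by linarith
qed

text \<open>In a small interval of length \<open>2 * h\<close> about a density point of
  \<open>C\<close>, a fine comb has measure at least \<open>\<theta> * h\<close>, while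
  \<open>C\<close> misses at most half of that. The bound \<open>c\<close> serves all large
  \<open>m\<close>, so that one comb can later work for finitely many reflections at once.\<close>

lemma measure_Int_comb_bounded_below:
  fixes C :: "real set"
  assumes C: "C \<in> sets lebesgue" "measure lebesgue C > 0" "C \<subseteq> {- real R<..<R}"
    and \<theta>: "0 < \<theta>" "\<theta> < 1"
  obtains c m\<^sub>0 where "c > 0" "\<And>m. m \<ge> m\<^sub>0 \<Longrightarrow> c \<le> measure lebesgue (C \<inter> comb \<theta> R m)"
proof -
  obtain N where N: "negligible N" "\<And>x e. \<lbrakk>x \<in> C - N; 0 < e\<rbrakk> \<Longrightarrow>
      \<exists>d>0. \<forall>h. 0 < h \<and> h < d \<longrightarrow> measure lebesgue ({x - h..x + h} - C) \<le> e * h"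
    using lebesgue_density_points[OF C(1)] by blast
  have "\<not> C \<subseteq> N"
    using N(1) C(2) negligible_subset negligible_imp_measure0 by (metis less_irrefl)
  then obtain x where x: "x \<in> C - N" by blast
  then obtain d where d: "d > 0"
    "\<And>h. 0 < h \<and> h < d \<Longrightarrow> measure lebesgue ({x - h..x + h} - C) \<le> \<theta> / 2 * h"
    using N(2)[of x "\<theta> / 2"] \<theta>(1) by auto
  \<comment> \<open>\<open>d / 2\<close> gives \<open>h < d\<close>. The other two terms keep the
    interval within the range of the comb and are positive because \<open>C\<close> lies in the open
    interval.\<close>
  define h where "h = min (d / 2) (min (R - x) (x + R))"
  have h: "0 < h" "h < d" "- real R \<le> x - h" "x + h \<le> R"
    using x C(3) d(1) by (auto simp: h_def)
  show ?thesis
  proof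
    show "\<theta> * h / 2 > 0" using h \<theta> by simp
  next
    fix m :: nat
    \<comment> \<open>For these \<open>m\<close> the loss \<open>2 * \<theta> / m\<close> at the
      ends is at most \<open>\<theta> * h\<close>, half of the main term.\<close>
    assume "m \<ge> nat \<lceil>2 / h\<rceil>"
    then have mh: "2 / h \<le> m" by linarith
    then have m: "0 < real m" using h(1) by (metis divide_pos_pos less_le_trans zero_less_numeral)
    let ?P = "comb \<theta> R m \<inter> {x - h..x + h}"
    have P: "?P \<in> lmeasurable"
      using compact_comb by (intro lmeasurable_compact) (auto intro: compact_Int)
    have "2 / m \<le> h" using mh m h(1) by (simp add: field_simps)
    then have "2 * \<theta> / m \<le> \<theta> * h" using mult_left_mono[of "2 / m" h \<theta>] \<theta> by (simp add: mult_ac)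
    then have "\<theta> * h \<le> \<theta> * ((x + h) - (x - h)) - 2 * \<theta> / m" by (simp add: algebra_simps)
    also have "\<dots> \<le> measure lebesgue ?P"
      using m h \<theta> by (intro measure_comb_Int_ge) auto
    also have "\<dots> \<le> measure lebesgue (?P \<inter> C) + measure lebesgue (?P - C)"
      by (rule measure_le_Int_plus_Diff[OF P C(1)])
    also have "measure lebesgue (?P \<inter> C) \<le> measure lebesgue (C \<inter> comb \<theta> R m)"
      using P C(1) lmeasurable_compact[OF compact_comb, of \<theta> R m]
      by (intro measure_mono_fmeasurable)
        (auto simp: Int_commute[of C] intro: fmeasurable_Int_fmeasurable)
    also have "measure lebesgue (?P - C) \<le> measure lebesgue ({x - h..x + h} - C)"
      using P C(1) by (intro measure_mono_fmeasurable fmeasurable_Diff) auto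
    also have "\<dots> \<le> \<theta> / 2 * h" using d(2) h by blast
    finally show "\<theta> * h / 2 \<le> measure lebesgue (C \<inter> comb \<theta> R m)" by simp
  qed
qed

section \<open>Null subsets of a compact set that meet its intersections with reflections\<close>

text \<open>Intersecting \<open>A\<close> with one comb suffices. A comb fine enough for
  \<open>s\<close> works for all \<open>t\<close> near \<open>s\<close>, since less than the lower
  bound \<open>c\<close> is lost in passing from \<open>s\<close> to \<open>t\<close>; compactness
  of \<open>S\<close> leaves finitely many \<open>s\<close> to consider.\<close>

lemma small_compact_subset_meeting_reflections:
  fixes A K S :: "real set"
  assumes A: "compact A" and K: "compact K" and S: "compact S" and "e > 0"
    and pos: "\<And>s. s \<in> S \<Longrightarrow> 0 < measure lebesgue (A \<inter> (-) s ` K)"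
  obtains A' where "A' \<subseteq> A" "compact A'" "measure lebesgue A' < e"
    "\<And>s. s \<in> S \<Longrightarrow> 0 < measure lebesgue (A' \<inter> (-) s ` K)"
proof -
  obtain r where "\<And>x. x \<in> A \<Longrightarrow> \<bar>x\<bar> \<le> r"
    using compact_imp_bounded[OF A] unfolding bounded_iff by auto
  moreover obtain R :: nat where "r < R" using reals_Archimedean2 by blast
  ultimately have R: "A \<subseteq> {- real R<..<R}" by (fastforce simp: abs_le_iff)
  \<comment> \<open>\<open>1/2\<close> keeps \<open>\<theta>\<close> below 1. The \<open>+ 1\<close>
    makes the denominator positive even for \<open>R = 0\<close> and the length bound of the comb
    strictly smaller than \<open>e\<close>.\<close>
  define \<theta> where "\<theta> = min (1/2) (e / (2 * R + 1))"
  have \<theta>: "0 < \<theta>" "\<theta> < 1" "2 * real R * \<theta> < e"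
  proof -
    show "0 < \<theta>" "\<theta> < 1" using \<open>e > 0\<close> by (auto simp: \<theta>_def)
    have "(2 * R + 1) * \<theta> \<le> (2 * R + 1) * (e / (2 * R + 1))"
      by (intro mult_left_mono) (auto simp: \<theta>_def)
    also have "\<dots> = e" by (simp add: field_simps)
    finally show "2 * real R * \<theta> < e" using \<open>0 < \<theta>\<close> by (simp add: algebra_simps)
  qed
  \<comment> \<open>\<open>d\<close> is chosen before \<open>m\<close>: the common fineness is known
    only once a finite subcover by the balls of radius \<open>d\<close> has been picked.\<close>
  have "\<exists>d m\<^sub>0. d > 0 \<and> (\<forall>m\<ge>m\<^sub>0. \<forall>t. \<bar>s - t\<bar> < d \<longrightarrow>
      0 < measure lebesgue ((A \<inter> comb \<theta> R m) \<inter> (-) t ` K))" if s: "s \<in> S" for s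
  proof -
    have "A \<inter> (-) s ` K \<in> sets lebesgue" "A \<inter> (-) s ` K \<subseteq> {- real R<..<R}"
      using lmeasurable_Int_compact_reflection[OF A K] R by auto
    then obtain c m\<^sub>0 where c: "c > 0"
      "\<And>m. m \<ge> m\<^sub>0 \<Longrightarrow> c \<le> measure lebesgue (A \<inter> (-) s ` K \<inter> comb \<theta> R m)"
      using measure_Int_comb_bounded_below[OF _ pos[OF s] _ \<theta>(1,2)] by metis
    obtain d where d: "d > 0"
      "\<And>s t. \<bar>s - t\<bar> < d \<Longrightarrow> measure lebesgue ((-) s ` K - (-) t ` K) < c"
      using reflection_continuous[OF K c(1)] by metis
    have "0 < measure lebesgue ((A \<inter> comb \<theta> R m) \<inter> (-) t ` K)" if "m \<ge> m\<^sub>0" "\<bar>s - t\<bar> < d" for m t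
    proof -
      have "compact (A \<inter> comb \<theta> R m)" using A compact_comb compact_Int by blast
      from measure_Int_reflection_le[OF this K, of s t] show ?thesis
        using c(2)[OF that(1)] d(2)[OF that(2)] by (simp add: Int_ac)
    qed
    with d(1) show ?thesis by blast
  qed
  then obtain d m\<^sub>0 where dm: "\<And>s. s \<in> S \<Longrightarrow> d s > 0"
    "\<And>s m t. \<lbrakk>s \<in> S; m \<ge> m\<^sub>0 s; \<bar>s - t\<bar> < d s\<rbrakk> \<Longrightarrow>
      0 < measure lebesgue ((A \<inter> comb \<theta> R m) \<inter> (-) t ` K)"
    by metis
  obtain D where D: "D \<subseteq> S" "finite D" "S \<subseteq> (\<Union>s\<in>D. ball s (d s))"
  proof (rule compactE_image[OF S, of S "\<lambda>s. ball s (d s)"])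
    show "S \<subseteq> (\<Union>s\<in>S. ball s (d s))" using dm(1) by force
  qed auto
  \<comment> \<open>The sum dominates each \<open>m\<^sub>0 s\<close> with \<open>s\<close> in
    \<open>D\<close>, and \<open>Suc\<close> makes \<open>m\<close> positive, as the length bound
    for combs requires.\<close>
  define m :: nat where "m = Suc (\<Sum>s\<in>D. m\<^sub>0 s)"
  have m: "m\<^sub>0 s \<le> m" if "s \<in> D" for s
    using member_le_sum[of s D m\<^sub>0] that D(2) by (simp add: m_def)
  show ?thesis
  proof
    show "A \<inter> comb \<theta> R m \<subseteq> A" by blast
    show "compact (A \<inter> comb \<theta> R m)" using A compact_comb compact_Int by blast
    have "measure lebesgue (A \<inter> comb \<theta> R m) \<le> measure lebesgue (comb \<theta> R m)"
      using A compact_comb[of \<theta> R m] by (intro measure_mono_fmeasurable sets.Int) (auto intro: fmeasurableD lmeasurable_compact)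
    also have "\<dots> \<le> 2 * real R * \<theta>" using \<theta>(1) by (intro measure_comb_le) (auto simp: m_def)
    finally show "measure lebesgue (A \<inter> comb \<theta> R m) < e" using \<theta>(3) by linarith
  next
    fix t assume "t \<in> S"
    then obtain s where "s \<in> D" "\<bar>s - t\<bar> < d s" using D(3) by (auto simp: dist_real_def)
    then show "0 < measure lebesgue ((A \<inter> comb \<theta> R m) \<inter> (-) t ` K)"
      using dm(2) m D(1) by blast
  qed
qed

lemma null_subset_meeting_reflections_compact:
  fixes A K S :: "real set"
  assumes A: "compact A" and K: "compact K" and S: "compact S"
    and pos: "\<And>s. s \<in> S \<Longrightarrow> 0 < measure lebesgue (A \<inter> (-) s ` K)"
  obtains N where "N \<subseteq> A" "N \<in> null_sets lebesgue" "\<And>s. s \<in> S \<Longrightarrow> N \<inter> (-) s ` K \<noteq> {}"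
proof -
  \<comment> \<open>Positive measure, not just nonemptiness, is carried along, since the next
    shrinking needs it.\<close>
  define Q where "Q X \<longleftrightarrow> X \<subseteq> A \<and> compact X \<and> (\<forall>s\<in>S. 0 < measure lebesgue (X \<inter> (-) s ` K))" for X
  have "\<exists>X. \<forall>n. Q (X n) \<and> (X (Suc n) \<subseteq> X n \<and> measure lebesgue (X (Suc n)) < inverse (Suc n))"
  proof (rule dependent_nat_choice)
    show "\<exists>X. Q X" using A pos by (auto simp: Q_def)
  next
    fix X and n :: nat
    assume "Q X"
    then show "\<exists>Y. Q Y \<and> (Y \<subseteq> X \<and> measure lebesgue Y < inverse (Suc n))"
      using small_compact_subset_meeting_reflections[of X K S "inverse (Suc n)"] K S
      unfolding Q_def by (metis inverse_positive_iff_positive of_nat_0_less_iff subset_trans zero_less_Suc)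
  qed
  then obtain X where X: "\<And>n. Q (X n)" "\<And>n. X (Suc n) \<subseteq> X n"
    "\<And>n. measure lebesgue (X (Suc n)) < inverse (Suc n)"
    by blast
  have Xc: "compact (X n)" for n using X(1) by (simp add: Q_def)
  show ?thesis
  proof
    show "(\<Inter>n. X n) \<subseteq> A" using X(1) unfolding Q_def by blast
    have "compact (\<Inter>n. X n)" using Xc by (intro compact_Inter) auto
    then have N: "(\<Inter>n. X n) \<in> lmeasurable" by (rule lmeasurable_compact)
    have "measure lebesgue (\<Inter>n. X n) \<le> inverse (Suc n)" for n
    proof -
      have "measure lebesgue (\<Inter>n. X n) \<le> measure lebesgue (X (Suc n))"
        using N Xc by (intro measure_mono_fmeasurable) (auto intro: lmeasurable_compact)
      then show ?thesis using X(3)[of n] by linarith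
    qed
    then have "measure lebesgue (\<Inter>n. X n) \<le> 0"
      by (intro LIMSEQ_le_const[OF LIMSEQ_inverse_real_of_nat]) blast
    then have "measure lebesgue (\<Inter>n. X n) = 0" using measure_nonneg[of lebesgue "\<Inter>n. X n"] by linarith
    with N show "(\<Inter>n. X n) \<in> null_sets lebesgue"
      by (auto simp: null_sets_def emeasure_eq_measure2)
  next
    fix s assume s: "s \<in> S"
    \<comment> \<open>In the limit only nonemptiness survives, by Cantor's intersection theorem for
      the compact traces on the reflection.\<close>
    have "\<Inter>(range (\<lambda>n. X n \<inter> (-) s ` K)) \<noteq> {}"
    proof (rule compact_nest)
      show "compact (X n \<inter> (-) s ` K)" for n
        using Xc compact_reflection[OF K] by (intro compact_Int)
      show "X n \<inter> (-) s ` K \<noteq> {}" for n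
        using X(1)[of n] s unfolding Q_def by (metis less_irrefl measure_empty)
      show "X n \<inter> (-) s ` K \<subseteq> X m \<inter> (-) s ` K" if "m \<le> n" for m n
        using lift_Suc_antimono_le[of X, OF X(2) that] by blast
    qed
    then show "(\<Inter>n. X n) \<inter> (-) s ` K \<noteq> {}" by blast
  qed
qed

text \<open>The \<open>s\<close> with positive measure need not form a compact set. They are
  exhausted by the compact sets with thresholds \<open>1 / (n + 1)\<close>, and the countably many
  null sets obtained are united.\<close>

lemma null_subset_meeting_reflections:
  fixes A K :: "real set"
  assumes A: "compact A" and K: "compact K"
  shows "\<exists>N. N \<subseteq> A \<and> N \<in> null_sets lebesgue \<and>
    (\<forall>s. 0 < measure lebesgue (A \<inter> (-) s ` K) \<longrightarrow> N \<inter> (-) s ` K \<noteq> {})"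
proof -
  have "\<exists>N. N \<subseteq> A \<and> N \<in> null_sets lebesgue \<and>
      (\<forall>s. inverse (Suc n) \<le> measure lebesgue (A \<inter> (-) s ` K) \<longrightarrow> N \<inter> (-) s ` K \<noteq> {})" for n
  proof -
    let ?S = "{s. inverse (Suc n) \<le> measure lebesgue (A \<inter> (-) s ` K)}"
    have "compact ?S" using A K by (intro compact_measure_Int_reflection_ge) auto
    moreover have "0 < measure lebesgue (A \<inter> (-) s ` K)" if "s \<in> ?S" for s
      using that by (rule_tac less_le_trans[of _ "inverse (Suc n)"]) auto
    ultimately obtain N where "N \<subseteq> A" "N \<in> null_sets lebesgue" "\<And>s. s \<in> ?S \<Longrightarrow> N \<inter> (-) s ` K \<noteq> {}"
      using null_subset_meeting_reflections_compact[OF A K] by metis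
    then show ?thesis by blast
  qed
  then obtain N where N: "\<And>n. N n \<subseteq> A" "\<And>n. N n \<in> null_sets lebesgue"
    "\<And>n s. inverse (Suc n) \<le> measure lebesgue (A \<inter> (-) s ` K) \<Longrightarrow> N n \<inter> (-) s ` K \<noteq> {}"
    by metis
  show ?thesis
  proof (intro exI[of _ "\<Union>n. N n"] conjI allI impI)
    fix s assume "0 < measure lebesgue (A \<inter> (-) s ` K)"
    then obtain n where "inverse (Suc n) < measure lebesgue (A \<inter> (-) s ` K)"
      using reals_Archimedean by blast
    then have "N n \<inter> (-) s ` K \<noteq> {}" using N(3) by (meson less_imp_le)
    then show "(\<Union>n. N n) \<inter> (-) s ` K \<noteq> {}" by blast
  qed (use N in auto)
qed

section \<open>From positive upper density to the theorem\<close>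

lemma upper_density_pos_frequently:
  assumes "upper_density B b > 0"
  obtains c where "c > 0"
    "\<And>d. d > 0 \<Longrightarrow> \<exists>h. 0 < h \<and> h < d \<and> c * h < measure lebesgue (B \<inter> {b - h..b + h})"
proof -
  obtain c where c: "0 < ereal c" "ereal c < upper_density B b"
    using ereal_dense2[OF assms] by blast
  show ?thesis
  proof
    \<comment> \<open>The density quotient divides by \<open>2 * h\<close>, so a quotient above
      \<open>c\<close> means a measure above \<open>2 * c * h\<close>.\<close>
    show "2 * c > 0" using c by simp
  next
    fix d :: real
    assume d: "d > 0"
    show "\<exists>h. 0 < h \<and> h < d \<and> 2 * c * h < measure lebesgue (B \<inter> {b - h..b + h})"
    proof (rule ccontr)
      assume neg: "\<not> ?thesis"
      have "\<forall>\<^sub>F h in at_right 0. ereal (measure lebesgue (B \<inter> {b - h..b + h}) / (2 * h)) \<le> ereal c"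
        using eventually_at_right_less[of "0::real"] eventually_at_right_real[OF d]
      proof eventually_elim
        case (elim h)
        then have "measure lebesgue (B \<inter> {b - h..b + h}) \<le> 2 * c * h" using neg by force
        then show ?case using elim by (simp add: field_simps)
      qed
      then have "upper_density B b \<le> ereal c" unfolding upper_density_def by (rule Limsup_bounded)
      then show False using c(2) by simp
    qed
  qed
qed

text \<open>The reflection that swaps \<open>a\<close> and \<open>b\<close> carries the part of
  \<open>B\<close> near \<open>b\<close> to a set of equal measure near \<open>a\<close>. At some
  small scale this is more than \<open>A\<close> omits there, so the overlap cannot be null.\<close>

lemma positive_measure_Int_reflection:
  fixes A B :: "real set"
  assumes A: "A \<in> sets lebesgue" and B: "B \<in> sets lebesgue" "upper_density B b > 0"
    and dens: "\<And>e. 0 < e \<Longrightarrow>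
      \<exists>d>0. \<forall>h. 0 < h \<and> h < d \<longrightarrow> measure lebesgue ({a - h..a + h} - A) \<le> e * h"
  shows "A \<inter> (-) (a + b) ` B \<notin> null_sets lebesgue"
proof
  assume null: "A \<inter> (-) (a + b) ` B \<in> null_sets lebesgue"
  obtain c where c: "c > 0"
    "\<And>d. d > 0 \<Longrightarrow> \<exists>h. 0 < h \<and> h < d \<and> c * h < measure lebesgue (B \<inter> {b - h..b + h})"
    using upper_density_pos_frequently[OF B(2)] by metis
  \<comment> \<open>The bound for \<open>A\<close> holds at all small scales and that for
    \<open>B\<close> at arbitrarily small ones, so a common \<open>h\<close> exists. The choice
    \<open>e = c\<close> is enough because the inequality for \<open>B\<close> is strict.\<close>
  obtain d where "d > 0" "\<And>h. 0 < h \<and> h < d \<Longrightarrow> measure lebesgue ({a - h..a + h} - A) \<le> c * h"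
    using dens[OF c(1)] by blast
  then obtain h where h: "0 < h" "c * h < measure lebesgue (B \<inter> {b - h..b + h})"
    "measure lebesgue ({a - h..a + h} - A) \<le> c * h"
    using c(2) by meson
  let ?P = "(-) (a + b) ` (B \<inter> {b - h..b + h})"
  have P: "?P \<in> sets lebesgue" using B(1) by (intro sets_lebesgue_reflection) auto
  have sub: "?P \<subseteq> {a - h..a + h}" by auto
  then have "?P \<in> lmeasurable" by (rule fmeasurableI2[OF _ _ P, rotated]) auto
  then have "measure lebesgue ?P \<le> measure lebesgue (?P \<inter> A) + measure lebesgue (?P - A)"
    using A by (rule measure_le_Int_plus_Diff)
  moreover have "?P \<inter> A \<in> null_sets lebesgue"
    using P A by (intro null_sets_subset[OF null]) auto
  then have "measure lebesgue (?P \<inter> A) = 0" by (simp add: null_sets_def measure_def)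
  moreover have "measure lebesgue (?P - A) \<le> measure lebesgue ({a - h..a + h} - A)"
    using sub P A by (intro measure_mono_fmeasurable fmeasurable_Diff) auto
  ultimately show False using h(2,3) by (simp add: measure_reflection)
qed

theorem theorem1p4:
  fixes A B :: "real set"
  assumes "A \<in> sets lebesgue"
    and "fsigma B"
    and "\<And>x. x \<in> B \<Longrightarrow> upper_density B x > 0"
  shows "\<exists>N. N \<subseteq> A \<and> N \<in> null_sets lebesgue \<and> N + B = A + B"
proof -
  obtain C T where CT: "fsigma C" "T \<in> null_sets lebesgue" "C \<union> T = A"
    using lebesgue_set_almost_fsigma[OF assms(1)] by metis
  obtain F :: "nat \<Rightarrow> real set" where "range F \<subseteq> Collect compact" and F_Un: "C = (\<Union>i. F i)"
    using CT(1) unfolding fsigma_Union_compact by metis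
  then have F: "compact (F i)" for i by blast
  obtain K :: "nat \<Rightarrow> real set" where "range K \<subseteq> Collect compact" and K_Un: "B = (\<Union>k. K k)"
    using assms(2) unfolding fsigma_Union_compact by metis
  then have K: "compact (K k)" for k by blast
  have B: "B \<in> sets lebesgue"
    unfolding K_Un using K lmeasurable_compact by blast
  obtain N0 where N0: "negligible N0" "\<And>x e. \<lbrakk>x \<in> A - N0; 0 < e\<rbrakk> \<Longrightarrow>
      \<exists>d>0. \<forall>h. 0 < h \<and> h < d \<longrightarrow> measure lebesgue ({x - h..x + h} - A) \<le> e * h"
    using lebesgue_density_points[OF assms(1)] by metis
  \<comment> \<open>\<open>M i k\<close> depends on the pair of pieces but not on \<open>s\<close>,
    so only countably many null sets are united.\<close>
  obtain M where M: "\<And>i k. M i k \<subseteq> F i" "\<And>i k. M i k \<in> null_sets lebesgue"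
    "\<And>i k s. 0 < measure lebesgue (F i \<inter> (-) s ` K k) \<Longrightarrow> M i k \<inter> (-) s ` K k \<noteq> {}"
    using null_subset_meeting_reflections[OF F K] by metis
  define N where "N = (A \<inter> N0) \<union> (\<Union>i. \<Union>k. M i k)"
  have "N \<subseteq> A" using M(1) F_Un CT(3) by (auto simp: N_def)
  moreover have "A \<inter> N0 \<in> null_sets lebesgue"
    using N0(1) negligible_iff_null_sets negligible_Int by blast
  then have "N \<in> null_sets lebesgue" unfolding N_def using M(2) by (intro null_sets.Un null_sets_UN) auto
  moreover have "A + B \<subseteq> N + B"
  proof
    fix s assume "s \<in> A + B"
    then obtain a b where ab: "a \<in> A" "b \<in> B" "s = a + b" by (rule set_plus_elim)
    show "s \<in> N + B"
    proof (cases "a \<in> N0")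
      case True
      then show ?thesis using ab by (auto simp: N_def)
    next
      case False
      have "A \<inter> (-) s ` B \<notin> null_sets lebesgue"
        unfolding ab(3) using assms(1) B assms(3)[OF ab(2)] N0(2) ab(1) False
        by (intro positive_measure_Int_reflection) auto
      \<comment> \<open>The pieces cover \<open>C\<close>, and the rest of \<open>A\<close> lies in
        the null set \<open>T\<close>; hence one of the countably many pieces is not null.\<close>
      moreover have "A \<inter> (-) s ` B = (\<Union>i. \<Union>k. F i \<inter> (-) s ` K k) \<union> (T \<inter> (-) s ` B)"
        unfolding CT(3)[symmetric] F_Un K_Un by blast
      moreover have "T \<inter> (-) s ` B \<in> null_sets lebesgue"
        using CT(2) sets_lebesgue_reflection[OF B] by (rule null_set_Int2)
      ultimately have "(\<Union>i. \<Union>k. F i \<inter> (-) s ` K k) \<notin> null_sets lebesgue"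
        by (metis null_sets.Un)
      then obtain i k where "F i \<inter> (-) s ` K k \<notin> null_sets lebesgue"
        using null_sets_UN by blast
      then have "measure lebesgue (F i \<inter> (-) s ` K k) \<noteq> 0"
        using lmeasurable_Int_compact_reflection[OF F K, of i s k]
        by (auto simp: null_sets_def emeasure_eq_measure2)
      then have "M i k \<inter> (-) s ` K k \<noteq> {}"
        using M(3) by (simp add: zero_less_measure_iff)
      \<comment> \<open>The sum \<open>s\<close> is kept but its representation changes:
        \<open>x\<close> replaces \<open>a\<close>, and \<open>s - x\<close> replaces
        \<open>b\<close>.\<close>
      then obtain x where "x \<in> M i k" "s - x \<in> K k"
        by (metis Int_iff ex_in_conv mem_reflection_iff)
      then have "x \<in> N" "s - x \<in> B" using K_Un by (auto simp: N_def)
      then have "x + (s - x) \<in> N + B" by (rule set_plus_intro)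
      then show ?thesis by simp
    qed
  qed
  ultimately show ?thesis using set_plus_mono2[of N A B B] by blast
qed

end
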